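(* For $m\in\mathbb{R}$ and $\alpha>-1$, $0<q=e^{-2k^2}<1$ and $|yzq|<1$, we have $$\int_{-\infty}^{+\infty}\frac{e^{-\theta^2+2m\theta}}{(zq^{1/2}e^{-2ik\theta};q)_\infty}\sum_{n=0}^\infty\frac{L_n^{(\alpha)}(x,y)\,h_n\bigl(-qe^{2mki},\,q^{1/2}e^{2ki\theta}\bigr)}{(q;q)_n}\,d\theta$$ $$=\sqrt{\pi}\,e^{m^2}\,\frac{(-zqe^{-2mki};q)_\infty}{(yzq;q)_\infty}\;{}_0\phi_1\left(\begin{gathered}-\\ q^{\alpha+1}\end{gathered};\,q,\,-q^{\alpha+2}xz\right).$$
   Context: Notation: $i=\sqrt{-1}$; $(a;q)_0=1$, $(a;q)_n=\prod_{j=0}^{n-1}(1-aq^j)$, $(a;q)_\infty=\prod_{j=0}^\infty(1-aq^j)$, $\begin{bmatrix} n\\ j\end{bmatrix}=\frac{(q;q)_n}{(q;q)_j(q;q)_{n-j}}$. The series ${}_0\phi_1\left(\begin{gathered}-\\ b\end{gathered};q,w\right)=\sum_{n=0}^\infty\frac{q^{n(n-1)}w^n}{(b;q)_n(q;q)_n}$. The homogeneous $q$-Laguerre polynomials are $L_n^{(\alpha)}(x,y)=\sum_{j=0}^n\begin{bmatrix} n\\ j\end{bmatrix}\frac{q^{j^2+j\alpha}}{(q^{\alpha+1};q)_j}(-x)^j y^{n-j}$. The homogeneous Rogers–Szegő polynomials are $h_n(x,y)=\sum_{j=0}^n\begin{bmatrix} n\\ j\end{bmatrix}x^jy^{n-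j}$.
   Formalization: Two hypotheses are added: |zq^{1/2}|<1 (for x=y=0, z=q^{-1/2} the integrand has a non-integrable pole at θ=0), and convergence of the series over n for every real θ (for x=z=0 it diverges when |y|q^{1/2}≥1). *)

theory Defs
  imports "HOL-Analysis.Analysis"
begin

definition qpoch :: "'a::comm_ring_1 \<Rightarrow> 'a \<Rightarrow> nat \<Rightarrow> 'a" where
  "qpoch a q n = (\<Prod>j<n. 1 - a * q ^ j)"

definition qpoch_inf :: "'a::real_normed_field \<Rightarrow> 'a \<Rightarrow> 'a" where
  "qpoch_inf a q = (\<Prod>j. 1 - a * q ^ j)"

definition qbinomial :: "'a::field \<Rightarrow> nat \<Rightarrow> nat \<Rightarrow> 'a" where
  "qbinomial q n j = qpoch q q n / (qpoch q q j * qpoch q q (n - j))"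

definition phi01 :: "complex \<Rightarrow> complex \<Rightarrow> complex \<Rightarrow> complex" where
  "phi01 b q w = (\<Sum>n. q ^ (n * (n - 1)) * w ^ n / (qpoch b q n * qpoch q q n))"

text \<open>Here \<open>q\<close> is real, and meant to be positive, because it is raised to real exponents.\<close>

definition q_laguerre :: "real \<Rightarrow> real \<Rightarrow> nat \<Rightarrow> complex \<Rightarrow> complex \<Rightarrow> complex" where
  "q_laguerre q \<alpha> n x y =
     (\<Sum>j\<le>n. of_real (qbinomial q n j * q powr (real j ^ 2 + real j * \<alpha>) / qpoch (q powr (\<alpha> + 1)) q j)
            * (- x) ^ j * y ^ (n - j))"

definition rogers_szego :: "real \<Rightarrow> nat \<Rightarrow> complex \<Rightarrow> complex \<Rightarrow> complex" where
  "rogers_szego q n x y = (\<Sum>j\<le>n. of_real (qbinomial q n j) * x ^ j * y ^ (n - j))"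

end

theory Submission
  imports Defs "HOL-Probability.Characteristic_Functions"
begin

text \<open>
  Put \<open>c\<^sub>n = L\<^sub>n(x,y)/(q;q)\<^sub>n\<close>. Expanding \<open>1/(u;q)\<^sub>\<infinity>\<close> and \<open>h\<^sub>n\<close> into powers of
  \<open>e\<^bsup>2ki\<theta>\<^esup>\<close> reduces everything to Gaussian Fourier integrals; the sum over \<open>h\<^sub>n\<close> is then evaluated by
  the \<open>q\<close>-binomial theorem at \<open>q\<^bsup>-i\<^esup>\<close>, which annihilates all terms with \<open>i < n\<close>, and Euler's
  identity shows that \<open>h\<^sub>n\<close> integrates to \<open>(zq)\<^sup>n\<close> times a constant. The theorem is thus the
  generating function of the \<open>c\<^sub>n\<close> at \<open>zq\<close>.

  Exchanging the outer sum with the integral needs \<open>\<Sum>\<^sub>n \<bar>c\<^sub>n\<bar> q\<^bsup>n/2\<^esup> < \<infinity>\<close>. Pointwise convergence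
  only gives \<open>c\<^sub>n q\<^bsup>n/2\<^esup> \<rightarrow> 0\<close>, but the generating function of the \<open>c\<^sub>n\<close> is an entire function divided
  by \<open>(yt;q)\<^sub>\<infinity>\<close>, hence meromorphic, so that this decay is automatically geometric.
\<close>

subsection \<open>\<open>q\<close>-Pochhammer symbols and \<open>q\<close>-series\<close>

lemma qpoch_0 [simp]: "qpoch a q 0 = 1"
  by (simp add: qpoch_def)

lemma qpoch_Suc: "qpoch a q (Suc n) = qpoch a q n * (1 - a * q ^ n)"
  by (simp add: qpoch_def)

lemma of_real_qpoch: "of_real (qpoch a q n) = qpoch (of_real a) (of_real q) n"
  by (simp add: qpoch_def)

lemma one_minus_mult_power_nonzero:
  fixes q :: "'a::real_normed_field"
  assumes "norm q < 1" "norm a < 1"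
  shows "1 - a * q ^ n \<noteq> 0"
proof
  assume "1 - a * q ^ n = 0"
  then have "norm (a * q ^ n) = 1" by simp
  moreover have "norm (a * q ^ n) \<le> norm a * 1"
    unfolding norm_mult norm_power using assms
    by (intro mult_left_mono power_le_one) auto
  ultimately show False using assms by linarith
qed

lemma qpoch_nonzero:
  fixes q :: "'a::real_normed_field"
  assumes "norm q < 1" "norm a < 1"
  shows "qpoch a q n \<noteq> 0"
  using one_minus_mult_power_nonzero[OF assms] by (simp add: qpoch_def)

lemma convergent_prod_qpoch:
  fixes q :: "'a::{real_normed_field,banach}"
  assumes "norm q < 1"
  shows "convergent_prod (\<lambda>j. 1 - a * q ^ j)"
proof (intro abs_convergent_prod_imp_convergent_prod summable_imp_abs_convergent_prod)
  have "summable (\<lambda>j. norm a * norm q ^ j)"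
    using assms by (intro summable_mult summable_geometric) simp
  then show "summable (\<lambda>j. norm (1 - a * q ^ j - 1))"
    by (simp add: norm_mult norm_power)
qed

lemma qpoch_tendsto_qpoch_inf:
  fixes q :: "'a::{real_normed_field,banach}"
  assumes "norm q < 1"
  shows "qpoch a q \<longlonglongrightarrow> qpoch_inf a q"
proof -
  have "(\<lambda>n. qpoch a q (Suc n)) \<longlonglongrightarrow> qpoch_inf a q"
    using convergent_prod_LIMSEQ[OF convergent_prod_qpoch[OF assms, of a]]
    by (simp add: qpoch_def qpoch_inf_def lessThan_Suc_atMost)
  then show ?thesis by (simp add: filterlim_sequentially_Suc)
qed

lemma qpoch_inf_nonzero:
  fixes q :: "'a::{real_normed_field,banach}"
  assumes "norm q < 1" "norm a < 1"
  shows "qpoch_inf a q \<noteq> 0"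
  unfolding qpoch_inf_def
  by (intro prodinf_nonzero convergent_prod_qpoch one_minus_mult_power_nonzero assms)

text \<open>The symbols converge to \<open>qpoch_inf a q\<close>, which is nonzero for
  \<open>norm a < 1\<close>, so the reciprocals converge as well and both sequences are
  bounded.\<close>

lemma qpoch_bounds:
  fixes q :: "'a::{real_normed_field,banach}"
  assumes "norm q < 1" "norm a < 1"
  obtains K where "K > 0" "\<And>n. norm (qpoch a q n) \<le> K" "\<And>n. norm (inverse (qpoch a q n)) \<le> K"
proof -
  note lim = qpoch_tendsto_qpoch_inf[OF assms(1), of a]
  have "Bseq (qpoch a q)" "Bseq (\<lambda>n. inverse (qpoch a q n))"
    using lim tendsto_inverse[OF lim qpoch_inf_nonzero[OF assms]]
    by (auto intro!: convergent_imp_Bseq convergentI)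
  then obtain K1 K2 where "K1 > 0" "\<And>n. norm (qpoch a q n) \<le> K1" "\<And>n. norm (inverse (qpoch a q n)) \<le> K2"
    by (metis BseqE)
  then show ?thesis using that[of "max K1 K2"] by (simp add: le_max_iff_disj less_max_iff_disj)
qed

lemma summable_inverse_qpoch:
  fixes q u :: "'a::{real_normed_field,banach}"
  assumes "norm q < 1" "norm u < 1"
  shows "summable (\<lambda>n. norm (u ^ n / qpoch q q n))"
proof -
  obtain K where K: "\<And>n. norm (inverse (qpoch q q n)) \<le> K"
    by (rule qpoch_bounds[OF assms(1,1)]) (rule that)
  show ?thesis
  proof (rule summable_comparison_test)
    show "summable (\<lambda>n. K * norm u ^ n)"
      using assms by (intro summable_mult summable_geometric) simp
    show "\<exists>N. \<forall>n\<ge>N. norm (norm (u ^ n / qpoch q q n)) \<le> K * norm u ^ n"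
    proof -
      have "norm (u ^ n / qpoch q q n) = norm (inverse (qpoch q q n)) * norm u ^ n" for n
        by (simp add: divide_inverse norm_mult norm_power)
      also have "\<dots> n \<le> K * norm u ^ n" for n
        by (intro mult_right_mono K) simp
      finally show ?thesis by simp
    qed
  qed
qed

section \<open>Euler's two series and the finite \<open>q\<close>-binomial theorem\<close>

lemma zero_choose_2 [simp]: "0 choose 2 = 0"
  by (simp add: numeral_2_eq_2)

lemma Suc_choose_2: "Suc n choose 2 = n + (n choose 2)"
  by (simp add: numeral_2_eq_2)

text \<open>Consecutive terms have ratio w q^n, which tends to 0 for every \<open>w\<close>. This
  quadratic decay is what makes the series below entire.\<close>

lemma summable_power_choose_2:
  fixes q w :: "'a::{real_normed_field,banach}"
  assumes "norm q < 1"
  shows "summable (\<lambda>n. norm (q ^ (n choose 2) * w ^ n))"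
proof -
  have "(\<lambda>n. norm w * norm q ^ n) \<longlonglongrightarrow> norm w * 0"
    using assms by (intro tendsto_mult tendsto_const LIMSEQ_power_zero) simp
  then have "eventually (\<lambda>n. norm w * norm q ^ n < 1/2) sequentially"
    by (rule order_tendstoD) simp
  then obtain N where N: "\<And>n. n \<ge> N \<Longrightarrow> norm w * norm q ^ n < 1/2"
    by (auto simp: eventually_sequentially)
  show ?thesis
  proof (rule summable_ratio_test[where c = "1/2" and N = N])
    fix n assume "n \<ge> N"
    have "norm (q ^ (Suc n choose 2) * w ^ Suc n)
        = (norm w * norm q ^ n) * norm (q ^ (n choose 2) * w ^ n)"
      by (simp add: Suc_choose_2 norm_mult norm_power power_add)
    also have "\<dots> \<le> 1/2 * norm (q ^ (n choose 2) * w ^ n)"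
      using N[OF \<open>n \<ge> N\<close>] by (intro mult_right_mono) auto
    finally show "norm (norm (q ^ (Suc n choose 2) * w ^ Suc n))
        \<le> 1/2 * norm (norm (q ^ (n choose 2) * w ^ n))" by simp
  qed simp
qed

lemma qpoch_q_Suc: "qpoch q q (Suc n) = qpoch q q n * (1 - q ^ Suc n)"
  by (simp add: qpoch_Suc)

text \<open>Euler's first identity. The series F satisfies F(vq) = (1 - v) F(v); iterating from
  \<open>u\<close> and letting u q^n tend to 0, continuity at 0 gives \<open>qpoch_inf u q\<close> *
  F(u) = F(0) = 1.\<close>

lemma qpoch_inf_inverse_series:
  fixes q u :: "'a::{real_normed_field,banach}"
  assumes q: "norm q < 1" and u: "norm u < 1"
  shows "(\<Sum>n. u ^ n / qpoch q q n) = inverse (qpoch_inf u q)"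
proof -
  define F where "F v = (\<Sum>n. inverse (qpoch q q n) * v ^ n)" for v :: 'a
  have sm: "summable (\<lambda>n. inverse (qpoch q q n) * v ^ n)" if "norm v < 1" for v
    using summable_norm_cancel[OF summable_inverse_qpoch[OF q that]]
    by (simp add: divide_inverse mult.commute)
  have nz: "qpoch q q n \<noteq> 0" for n by (rule qpoch_nonzero[OF q q])
  have nz': "1 - q ^ Suc n \<noteq> 0" for n
    using one_minus_mult_power_nonzero[OF q q, of n] by simp
  have step: "F (v * q) = (1 - v) * F v" if v: "norm v < 1" for v
  proof -
    have vq: "norm (v * q) < 1"
      using mult_strict_mono[OF v q] by (simp add: norm_mult)
    have "F v - F (v * q) = (\<Sum>n. inverse (qpoch q q n) * v ^ n - inverse (qpoch q q n) * (v * q) ^ n)"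
      unfolding F_def by (rule suminf_diff[OF sm[OF v] sm[OF vq]])
    also have "\<dots> = (\<Sum>n. inverse (qpoch q q (Suc n)) * v ^ Suc n
        - inverse (qpoch q q (Suc n)) * (v * q) ^ Suc n)"
      by (subst suminf_split_head[OF summable_diff[OF sm[OF v] sm[OF vq]]]) simp
    also have "\<dots> = (\<Sum>n. v * (inverse (qpoch q q n) * v ^ n))"
    proof (intro suminf_cong)
      fix n
      have "inverse (qpoch q q (Suc n)) * v ^ Suc n - inverse (qpoch q q (Suc n)) * (v * q) ^ Suc n
          = v * v ^ n * ((1 - q ^ Suc n) * inverse (qpoch q q (Suc n)))"
        by (simp add: power_mult_distrib algebra_simps)
      also have "(1 - q ^ Suc n) * inverse (qpoch q q (Suc n)) = inverse (qpoch q q n)"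
        using nz'[of n] nz[of n] unfolding qpoch_q_Suc by (simp only: inverse_mult_distrib) simp
      finally show "inverse (qpoch q q (Suc n)) * v ^ Suc n - inverse (qpoch q q (Suc n)) * (v * q) ^ Suc n
          = v * (inverse (qpoch q q n) * v ^ n)" by (simp only: mult_ac)
    qed
    also have "\<dots> = v * F v"
      unfolding F_def by (rule suminf_mult[OF sm[OF v]])
    finally show ?thesis by (simp add: algebra_simps)
  qed
  have iter: "F (u * q ^ n) = qpoch u q n * F u" for n
  proof (induction n)
    case (Suc n)
    have "norm (u * q ^ n) \<le> norm u * 1"
      unfolding norm_mult norm_power using q by (intro mult_left_mono power_le_one) auto
    then have "norm (u * q ^ n) < 1" using u by simp
    from step[OF this] Suc show ?case
      by (simp add: qpoch_Suc mult_ac)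
  qed simp
  have "isCont F 0"
    \<comment> \<open>The radius 1/2 only serves as a nonzero point of the disc of
      convergence.\<close>
    unfolding F_def by (rule isCont_powser[where K = "of_real (1/2)"], rule sm) auto
  moreover have "(\<lambda>n. u * q ^ n) \<longlonglongrightarrow> 0"
    using tendsto_mult[OF tendsto_const[of u] LIMSEQ_power_zero[OF q]] by simp
  ultimately have "(\<lambda>n. F (u * q ^ n)) \<longlonglongrightarrow> F 0"
    by (rule isCont_tendsto_compose)
  moreover have "(\<lambda>n. F (u * q ^ n)) \<longlonglongrightarrow> qpoch_inf u q * F u"
    unfolding iter by (intro tendsto_mult tendsto_const qpoch_tendsto_qpoch_inf[OF q])
  moreover have "F 0 = 1"
    unfolding F_def by (simp add: powser_zero)
  ultimately have "qpoch_inf u q * F u = 1"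
    using LIMSEQ_unique by metis
  then have "F u = inverse (qpoch_inf u q)"
    by (metis inverse_unique)
  then show ?thesis
    by (simp add: F_def divide_inverse mult.commute)
qed

text \<open>Euler's second identity, by the same method: here the series G satisfies G(v) = (1 + v)
  G(vq), and it converges for every argument, so \<open>w\<close> is unrestricted.\<close>

lemma qpoch_inf_series:
  fixes q w :: "'a::{real_normed_field,banach}"
  assumes q: "norm q < 1"
  shows "(\<Sum>n. q ^ (n choose 2) * w ^ n / qpoch q q n) = qpoch_inf (- w) q"
    and "summable (\<lambda>n. q ^ (n choose 2) * w ^ n / qpoch q q n)"
proof -
  define c where "c n = q ^ (n choose 2) / qpoch q q n" for n
  define G where "G v = (\<Sum>n. c n * v ^ n)" for v :: 'a
  obtain K where K: "\<And>n. norm (inverse (qpoch q q n)) \<le> K"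
    by (rule qpoch_bounds[OF q q]) (rule that)
  have sm: "summable (\<lambda>n. c n * v ^ n)" for v
  proof (rule summable_comparison_test)
    show "summable (\<lambda>n. K * norm (q ^ (n choose 2) * v ^ n))"
      by (intro summable_mult summable_power_choose_2 q)
    have "norm (c n * v ^ n) = norm (inverse (qpoch q q n)) * norm (q ^ (n choose 2) * v ^ n)" for n
      by (simp add: c_def divide_inverse norm_mult)
    then show "\<exists>N. \<forall>n\<ge>N. norm (c n * v ^ n) \<le> K * norm (q ^ (n choose 2) * v ^ n)"
      by (metis K mult_right_mono norm_ge_zero)
  qed
  have nz: "qpoch q q n \<noteq> 0" for n by (rule qpoch_nonzero[OF q q])
  have nz': "1 - q ^ Suc n \<noteq> 0" for n
    using one_minus_mult_power_nonzero[OF q q, of n] by simp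
  have step: "G v = (1 + v) * G (v * q)" for v
  proof -
    have "G v - G (v * q) = (\<Sum>n. c n * v ^ n - c n * (v * q) ^ n)"
      unfolding G_def by (rule suminf_diff[OF sm sm])
    also have "\<dots> = (\<Sum>n. c (Suc n) * v ^ Suc n - c (Suc n) * (v * q) ^ Suc n)"
      by (subst suminf_split_head[OF summable_diff[OF sm sm]]) simp
    also have "\<dots> = (\<Sum>n. v * (c n * (v * q) ^ n))"
    proof (intro suminf_cong)
      fix n
      have "c (Suc n) * v ^ Suc n - c (Suc n) * (v * q) ^ Suc n
          = v * v ^ n * ((1 - q ^ Suc n) * c (Suc n))"
        by (simp add: power_mult_distrib algebra_simps)
      also have "(1 - q ^ Suc n) * c (Suc n) = q ^ n * c n"
        using nz'[of n] nz[of n] unfolding qpoch_q_Suc c_def Suc_choose_2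
        by (simp add: power_add del: power_Suc)
      finally show "c (Suc n) * v ^ Suc n - c (Suc n) * (v * q) ^ Suc n = v * (c n * (v * q) ^ n)"
        by (simp only: mult_ac power_mult_distrib)
    qed
    also have "\<dots> = v * G (v * q)"
      unfolding G_def by (rule suminf_mult[OF sm])
    finally show ?thesis by (simp add: algebra_simps)
  qed
  have iter: "G w = qpoch (- w) q n * G (w * q ^ n)" for n
  proof (induction n)
    case (Suc n)
    with step[of "w * q ^ n"] show ?case
      by (simp add: qpoch_Suc mult_ac)
  qed simp
  have "isCont G 0"
    unfolding G_def by (rule isCont_powser_converges_everywhere[OF sm])
  moreover have "(\<lambda>n. w * q ^ n) \<longlonglongrightarrow> 0"
    using tendsto_mult[OF tendsto_const[of w] LIMSEQ_power_zero[OF q]] by simp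
  ultimately have "(\<lambda>n. G (w * q ^ n)) \<longlonglongrightarrow> G 0"
    by (rule isCont_tendsto_compose)
  then have "(\<lambda>n. qpoch (- w) q n * G (w * q ^ n)) \<longlonglongrightarrow> qpoch_inf (- w) q * G 0"
    by (intro tendsto_mult qpoch_tendsto_qpoch_inf[OF q])
  then have "(\<lambda>n. G w) \<longlonglongrightarrow> qpoch_inf (- w) q * G 0"
    by (simp only: iter[symmetric])
  moreover have "G 0 = 1"
    unfolding G_def powser_zero by (simp add: c_def)
  ultimately have "G w = qpoch_inf (- w) q"
    using LIMSEQ_unique[OF tendsto_const] by (metis mult.right_neutral)
  then show "(\<Sum>n. q ^ (n choose 2) * w ^ n / qpoch q q n) = qpoch_inf (- w) q"
    by (simp add: G_def c_def)
  show "summable (\<lambda>n. q ^ (n choose 2) * w ^ n / qpoch q q n)"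
    using sm[of w] by (simp add: c_def)
qed

text \<open>Dividing the sum by (q;q)_n gives g, and the claim becomes a first-order recurrence in
  \<open>n\<close>. It comes from splitting 1 - q^(n+1) into (1 - q^(n+1-j)) + q^(n+1-j) (1 - q^j):
  each part cancels one factor of a denominator and returns a multiple of g(n).\<close>

lemma q_binomial_theorem:
  fixes q v :: "'a::real_normed_field"
  assumes q: "norm q < 1"
  shows "(\<Sum>j\<le>n. qbinomial q n j * (- 1) ^ j * q ^ (j choose 2) * v ^ j) = qpoch v q n"
proof -
  define g where "g n = (\<Sum>j\<le>n. (- v) ^ j * q ^ (j choose 2) / (qpoch q q j * qpoch q q (n - j)))" for n
  have nz: "qpoch q q n \<noteq> 0" for n by (rule qpoch_nonzero[OF q q])
  have nz': "1 - q ^ Suc n \<noteq> 0" for n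
    using one_minus_mult_power_nonzero[OF q q, of n] by simp
  have ratio: "(1 - q ^ Suc n) / qpoch q q (Suc n) = 1 / qpoch q q n" for n
    using nz nz' by (simp add: qpoch_q_Suc del: power_Suc)
  have step: "(1 - q ^ Suc n) * g (Suc n) = (1 - v * q ^ n) * g n" for n
  proof -
    define t where "t j = (- v) ^ j * q ^ (j choose 2) / (qpoch q q j * qpoch q q (Suc n - j))" for j
    have "(1 - q ^ Suc n) * g (Suc n) = (\<Sum>j\<le>Suc n. (1 - q ^ (Suc n - j)) * t j + q ^ (Suc n - j) * (1 - q ^ j) * t j)"
      unfolding g_def t_def[symmetric] sum_distrib_left
    proof (intro sum.cong refl)
      fix j assume "j \<in> {..Suc n}"
      then have "q ^ Suc n = q ^ (Suc n - j) * q ^ j"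
        by (metis atMost_iff le_add_diff_inverse2 power_add)
      then show "(1 - q ^ Suc n) * t j = (1 - q ^ (Suc n - j)) * t j + q ^ (Suc n - j) * (1 - q ^ j) * t j"
        by (simp add: algebra_simps)
    qed
    also have "\<dots> = (\<Sum>j\<le>Suc n. (1 - q ^ (Suc n - j)) * t j) + (\<Sum>j\<le>Suc n. q ^ (Suc n - j) * (1 - q ^ j) * t j)"
      by (rule sum.distrib)
    also have "(\<Sum>j\<le>Suc n. (1 - q ^ (Suc n - j)) * t j) = (\<Sum>j\<le>n. (1 - q ^ (Suc n - j)) * t j)"
      by (simp add: atMost_Suc)
    also have "\<dots> = g n"
      unfolding g_def
    proof (intro sum.cong refl)
      fix j assume "j \<in> {..n}"
      then have "(1 - q ^ (Suc n - j)) / qpoch q q (Suc n - j) = 1 / qpoch q q (n - j)"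
        using ratio[of "n - j"] by (simp add: Suc_diff_le)
      then show "(1 - q ^ (Suc n - j)) * t j
          = (- v) ^ j * q ^ (j choose 2) / (qpoch q q j * qpoch q q (n - j))"
        by (simp add: t_def divide_inverse mult_ac del: power_Suc)
    qed
    also have "(\<Sum>j\<le>Suc n. q ^ (Suc n - j) * (1 - q ^ j) * t j)
        = (\<Sum>j\<le>n. q ^ (n - j) * (1 - q ^ Suc j) * t (Suc j))"
      by (subst sum.atMost_Suc_shift) simp
    also have "\<dots> = - v * q ^ n * g n"
      unfolding g_def sum_distrib_left
    proof (intro sum.cong refl)
      fix j assume j: "j \<in> {..n}"
      have "q ^ (n - j) * (1 - q ^ Suc j) * t (Suc j) =
        ((1 - q ^ Suc j) / qpoch q q (Suc j)) * (- v * (q ^ (n - j) * q ^ j)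
          * (- v) ^ j * q ^ (j choose 2) / qpoch q q (n - j))"
        by (simp add: t_def Suc_choose_2 power_add mult_ac)
      also have "q ^ (n - j) * q ^ j = q ^ n"
        using j by (metis atMost_iff le_add_diff_inverse2 power_add)
      finally show "q ^ (n - j) * (1 - q ^ Suc j) * t (Suc j) =
          - v * q ^ n * ((- v) ^ j * q ^ (j choose 2) / (qpoch q q j * qpoch q q (n - j)))"
        unfolding ratio by (simp add: mult_ac)
    qed
    finally show ?thesis by (simp add: algebra_simps)
  qed
  have "qpoch q q n * g n = qpoch v q n"
  proof (induction n)
    case (Suc n)
    have "qpoch q q (Suc n) * g (Suc n) = qpoch q q n * ((1 - q ^ Suc n) * g (Suc n))"
      by (simp only: qpoch_q_Suc mult.assoc)
    also have "\<dots> = qpoch v q (Suc n)"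
      unfolding step Suc[symmetric] qpoch_Suc by (simp only: mult_ac)
    finally show ?case .
  qed (simp add: g_def)
  then show ?thesis
    unfolding g_def sum_distrib_left qbinomial_def
    by (simp add: power_minus[of v] mult_ac)
qed

text \<open>The product at q^(-i) is a quotient of ordinary symbols up to sign and a power of
  \<open>q\<close>. The factors \<open>q ^ (i * n)\<close> and \<open>qpoch q q (i - n)\<close>
  clear the negative powers and the denominator.\<close>

lemma qpoch_inverse_power:
  fixes q :: "'a::field"
  assumes "q \<noteq> 0" "n \<le> i"
  shows "qpoch (inverse q ^ i) q n * qpoch q q (i - n) * q ^ (i * n)
    = (- 1) ^ n * q ^ (n choose 2) * qpoch q q i"
  using assms(2)
proof (induction n)
  case (Suc n)
  define l where "l = i - Suc n"
  have i: "i = n + Suc l" using Suc.prems by (simp add: l_def)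
  have e: "(1 - inverse q ^ i * q ^ n) * q ^ i = - (q ^ n) * (1 - q ^ Suc l)"
    using assms(1) by (simp add: algebra_simps power_inverse i power_add)
  have "qpoch (inverse q ^ i) q (Suc n) * qpoch q q l * q ^ (i * Suc n)
      = qpoch (inverse q ^ i) q n * q ^ (i * n) * qpoch q q l * ((1 - inverse q ^ i * q ^ n) * q ^ i)"
    by (simp add: qpoch_Suc power_add mult_ac)
  also have "\<dots> = - (q ^ n) * (qpoch (inverse q ^ i) q n * qpoch q q (Suc l) * q ^ (i * n))"
    unfolding e qpoch_q_Suc by (simp only: mult_ac mult_minus_left mult_minus_right)
  also have "Suc l = i - n" using i by simp
  finally show ?case
    using Suc by (simp add: Suc_choose_2 power_add mult_ac l_def)
qed simp

text \<open>The factor with index \<open>i\<close> is 1 - q^(-i) q^i = 0.\<close>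

lemma qpoch_inverse_power_eq_0:
  fixes q :: "'a::field"
  assumes "q \<noteq> 0" "i < n"
  shows "qpoch (inverse q ^ i) q n = 0"
  unfolding qpoch_def
  using assms by (auto simp: power_inverse intro!: prod_zero bexI[of _ i])

subsection \<open>Integration and decay of coefficients\<close>

text \<open>A product bound, summable in \<open>n\<close> times integrable in \<open>x\<close>,
  yields both pointwise absolute convergence and summability of the integrals of the norms.\<close>

lemma has_bochner_integral_suminf:
  fixes f :: "nat \<Rightarrow> 'a \<Rightarrow> 'b::{banach, second_countable_topology}"
  assumes f: "\<And>n. has_bochner_integral M (f n) (I n)"
    and g: "integrable M g" and B: "summable B"
    and bound: "\<And>n x. norm (f n x) \<le> B n * g x"
  shows "has_bochner_integral M (\<lambda>x. \<Sum>n. f n x) (\<Sum>n. I n)" and "summable I"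
proof -
  have int: "integrable M (f n)" for n using f has_bochner_integral_iff by blast
  have I: "I n = integral\<^sup>L M (f n)" for n using f has_bochner_integral_iff by metis
  have 1: "AE x in M. summable (\<lambda>n. norm (f n x))"
    using bound by (intro AE_I2 summable_comparison_test[OF _ summable_mult2[OF B]]) auto
  have 2: "summable (\<lambda>n. \<integral>x. norm (f n x) \<partial>M)"
  proof (rule summable_comparison_test)
    show "summable (\<lambda>n. B n * integral\<^sup>L M g)"
      by (rule summable_mult2[OF B])
    have "(\<integral>x. norm (f n x) \<partial>M) \<le> (\<integral>x. B n * g x \<partial>M)" for n
      using int g bound by (intro integral_mono) auto
    then show "\<exists>N. \<forall>n\<ge>N. norm (\<integral>x. norm (f n x) \<partial>M) \<le> B n * integral\<^sup>L M g"
      by simp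
  qed
  note c = int 1 2
  show "has_bochner_integral M (\<lambda>x. \<Sum>n. f n x) (\<Sum>n. I n)"
    unfolding has_bochner_integral_iff I
    using integrable_suminf[OF c] integral_suminf[OF c] by simp
  show "summable I"
    using sums_integral[OF c] unfolding I by (rule sums_summable)
qed

text \<open>The characteristic function of the standard normal law at sqrt 2 * t, after the affine
  substitution sqrt 2 * (x - m), which completes the square and produces the factors in
  \<open>m\<close>.\<close>

lemma has_bochner_integral_gaussian_exp:
  "has_bochner_integral lborel
     (\<lambda>\<theta>. of_real (exp (- (\<theta> ^ 2) + 2 * m * \<theta>)) * exp (2 * \<i> * of_real (t * \<theta>)))
     (of_real (sqrt pi * exp (m ^ 2)) * exp (2 * \<i> * of_real (m * t)) * of_real (exp (- (t ^ 2))))"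
proof -
  define f where "f x = std_normal_density x *\<^sub>R iexp (sqrt 2 * t * x)" for x
  have char: "char std_normal_distribution (sqrt 2 * t) = of_real (exp (- (t ^ 2)))"
    unfolding char_std_normal_distribution by (simp add: power_mult_distrib)
  interpret real_distribution std_normal_distribution by (rule real_dist_normal_dist)
  have "integrable std_normal_distribution (\<lambda>x. iexp (sqrt 2 * t * x))"
    by (rule integrable_const_bound[where B = 1]) auto
  then have "integrable lborel f"
    unfolding f_def by (subst (asm) integrable_density) auto
  moreover have "integral\<^sup>L lborel f = of_real (exp (- (t ^ 2)))"
    unfolding f_def char[symmetric] char_def by (subst integral_density) auto
  ultimately have "has_bochner_integral lborel f (of_real (exp (- (t ^ 2))))"
    by (simp add: has_bochner_integral_iff)
  then have "has_bochner_integral lborel (\<lambda>x. f (- (sqrt 2 * m) + sqrt 2 * x))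
      (of_real (exp (- (t ^ 2))) /\<^sub>R \<bar>sqrt 2\<bar>)"
    by (subst (asm) lborel_has_bochner_integral_real_affine_iff[where c = "sqrt 2" and t = "- (sqrt 2 * m)"]) auto
  then have "has_bochner_integral lborel
     (\<lambda>x. (of_real (sqrt (2 * pi) * exp (m ^ 2)) * exp (2 * \<i> * of_real (m * t))) * f (- (sqrt 2 * m) + sqrt 2 * x))
     ((of_real (sqrt (2 * pi) * exp (m ^ 2)) * exp (2 * \<i> * of_real (m * t))) * (of_real (exp (- (t ^ 2))) /\<^sub>R \<bar>sqrt 2\<bar>))"
    by (intro has_bochner_integral_mult_right)
  moreover have "(of_real (sqrt (2 * pi) * exp (m ^ 2)) * exp (2 * \<i> * of_real (m * t))) * f (- (sqrt 2 * m) + sqrt 2 * x)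
    = of_real (exp (- (x ^ 2) + 2 * m * x)) * exp (2 * \<i> * of_real (t * x))" for x
  proof -
    have e1: "exp (m ^ 2) * exp (- ((- (sqrt 2 * m) + sqrt 2 * x)\<^sup>2) / 2) = exp (- (x ^ 2) + 2 * m * x)"
    proof -
      have "(- (sqrt 2 * m) + sqrt 2 * x)\<^sup>2 = 2 * (x - m)\<^sup>2"
        by (simp add: power2_eq_square algebra_simps)
      then have "- ((- (sqrt 2 * m) + sqrt 2 * x)\<^sup>2) / 2 = - ((x - m)\<^sup>2)" by simp
      then show ?thesis
        by (simp add: exp_add[symmetric] power2_eq_square algebra_simps)
    qed
    have e2: "exp (2 * \<i> * of_real (m * t)) * iexp (sqrt 2 * t * (- (sqrt 2 * m) + sqrt 2 * x))
        = exp (2 * \<i> * of_real (t * x))"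
    proof -
      have "sqrt 2 * t * (- (sqrt 2 * m) + sqrt 2 * x) = 2 * t * (x - m)"
        by (simp add: algebra_simps)
      then show ?thesis
        by (simp add: exp_add[symmetric] algebra_simps)
    qed
    have "(of_real (sqrt (2 * pi) * exp (m ^ 2)) * exp (2 * \<i> * of_real (m * t))) * f (- (sqrt 2 * m) + sqrt 2 * x)
      = of_real (sqrt (2 * pi) * exp (m ^ 2) * std_normal_density (- (sqrt 2 * m) + sqrt 2 * x))
        * (exp (2 * \<i> * of_real (m * t)) * iexp (sqrt 2 * t * (- (sqrt 2 * m) + sqrt 2 * x)))"
      by (simp only: f_def scaleR_conv_of_real of_real_mult mult_ac)
    also have "sqrt (2 * pi) * exp (m ^ 2) * std_normal_density (- (sqrt 2 * m) + sqrt 2 * x)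
       = exp (m ^ 2) * exp (- ((- (sqrt 2 * m) + sqrt 2 * x)\<^sup>2) / 2)"
      by (simp add: std_normal_density_def)
    finally show ?thesis unfolding e1 e2 .
  qed
  moreover have "(of_real (sqrt (2 * pi) * exp (m ^ 2)) * exp (2 * \<i> * of_real (m * t))) * (of_real (exp (- (t ^ 2))) /\<^sub>R \<bar>sqrt 2\<bar>)
     = of_real (sqrt pi * exp (m ^ 2)) * exp (2 * \<i> * of_real (m * t)) * of_real (exp (- (t ^ 2)))"
    by (simp add: scaleR_conv_of_real real_sqrt_mult field_simps)
  ultimately show ?thesis by simp
qed

section \<open>Geometric decay from convergence to zero\<close>

text \<open>For \<open>\<bar>w\<bar> \<ge> 1\<close> the recurrence is solved backwards from infinity, where \<open>c\<close> vanishes.\<close>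

lemma geometric_bound_from_recurrence:
  fixes c :: "nat \<Rightarrow> 'a::real_normed_field"
  assumes lim: "c \<longlonglongrightarrow> 0"
    and rho: "0 < \<rho>" "\<rho> < 1" and C: "\<And>n. norm (c (Suc n) - w * c n) \<le> C * \<rho> ^ n"
  obtains C' \<rho>' where "0 < \<rho>'" "\<rho>' < 1" "\<And>n. norm (c n) \<le> C' * \<rho>' ^ n"
proof (cases "norm w < 1")
  case True
  obtain r where r: "max \<rho> (norm w) < r" "r < 1"
    using dense[of "max \<rho> (norm w)" 1] True rho by auto
  \<comment> \<open>The first entry starts the induction; the second gives C + |w| C' \<le> C' r,
    which is what the induction step needs.\<close>
  define C' where "C' = max (norm (c 0)) (C / (r - norm w))"
  have C0: "0 \<le> C" using order_trans[OF norm_ge_zero C[of 0]] by simp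
  have CC': "C \<le> C' * (r - norm w)"
    using r by (simp add: C'_def pos_divide_le_eq[symmetric])
  have "norm (c n) \<le> C' * r ^ n" for n
  proof (induction n)
    case (Suc n)
    have "norm (c (Suc n)) \<le> norm (c (Suc n) - w * c n) + norm w * norm (c n)"
      by (metis add.commute norm_triangle_sub norm_mult)
    also have "\<dots> \<le> C * r ^ n + norm w * (C' * r ^ n)"
    proof (intro add_mono mult_left_mono Suc)
      have "C * \<rho> ^ n \<le> C * r ^ n"
        using r rho C0 by (intro mult_left_mono power_mono) auto
      then show "norm (c (Suc n) - w * c n) \<le> C * r ^ n"
        using C[of n] by linarith
    qed auto
    also have "\<dots> = (C + norm w * C') * r ^ n" by (simp add: algebra_simps)
    also have "\<dots> \<le> (C' * r) * r ^ n"
      using CC' r rho by (intro mult_right_mono) (auto simp: algebra_simps)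
    finally show ?case by simp
  qed (simp add: C'_def)
  then show ?thesis using r rho by (intro that[of r]) auto
next
  case False
  have C0: "0 \<le> C" using order_trans[OF norm_ge_zero C[of 0]] by simp
  have step: "norm (c n) \<le> norm (c (Suc n)) + C * \<rho> ^ n" for n
  proof -
    have "norm (c n) \<le> norm w * norm (c n)"
      using False by (simp add: mult_le_cancel_right1)
    also have "\<dots> \<le> norm (c (Suc n)) + norm (c (Suc n) - w * c n)"
      by (metis norm_minus_commute norm_mult norm_triangle_sub)
    finally show ?thesis using C[of n] by linarith
  qed
  have iter: "norm (c n) \<le> norm (c (n + N)) + C * \<rho> ^ n * (\<Sum>j<N. \<rho> ^ j)" for n N
  proof (induction N)
    case (Suc N)
    then show ?case using step[of "n + N"] by (simp add: algebra_simps power_add)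
  qed simp
  have "norm (c n) \<le> C / (1 - \<rho>) * \<rho> ^ n" for n
  proof (rule LIMSEQ_le_const)
    have "(\<lambda>N. norm (c (N + n))) \<longlonglongrightarrow> norm (0::'a)"
      by (intro tendsto_norm LIMSEQ_ignore_initial_segment lim)
    moreover have "(\<lambda>N. \<Sum>j<N. \<rho> ^ j) \<longlonglongrightarrow> 1 / (1 - \<rho>)"
      using geometric_sums[of \<rho>] rho by (simp add: sums_def)
    ultimately have "(\<lambda>N. norm (c (N + n)) + C * \<rho> ^ n * (\<Sum>j<N. \<rho> ^ j)) \<longlonglongrightarrow> norm (0::'a) + C * \<rho> ^ n * (1 / (1 - \<rho>))"
      by (intro tendsto_add tendsto_mult tendsto_const)
    then show "(\<lambda>N. norm (c (n + N)) + C * \<rho> ^ n * (\<Sum>j<N. \<rho> ^ j)) \<longlonglongrightarrow> C / (1 - \<rho>) * \<rho> ^ n"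
      by (simp add: add.commute)
    show "\<exists>N. \<forall>k\<ge>N. norm (c n) \<le> norm (c (n + k)) + C * \<rho> ^ n * (\<Sum>j<k. \<rho> ^ j)"
      using iter by blast
  qed
  then show ?thesis using rho by (intro that[of \<rho> "C / (1 - \<rho>)"]) auto
qed

text \<open>Multiplying the generating function by \<open>1 - w t\<close> turns \<open>w\<close> into \<open>w q\<close>; after finitely many
  steps \<open>w\<close> is small and the bound is immediate, and it is pulled back through the recurrence.\<close>

lemma geometric_bound_convolution_qpoch:
  fixes q w :: "'a::{real_normed_field,banach}" and f :: "nat \<Rightarrow> 'a"
  assumes q: "norm q < 1"
    and f: "summable (\<lambda>n. norm (f n) * 4 ^ n)"
    and lim: "(\<lambda>n. \<Sum>j\<le>n. f j * w ^ (n - j) / qpoch q q (n - j)) \<longlonglongrightarrow> 0"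
  obtains C \<rho> where "0 < \<rho>" "\<rho> < 1"
    "\<And>n. norm (\<Sum>j\<le>n. f j * w ^ (n - j) / qpoch q q (n - j)) \<le> C * \<rho> ^ n"
proof -
  define e where "e w n = (\<Sum>j\<le>n. f j * w ^ (n - j) / qpoch q q (n - j))" for w n
  have nz: "qpoch q q n \<noteq> 0" for n by (rule qpoch_nonzero[OF q q])
  have nz': "1 - q ^ Suc n \<noteq> 0" for n
    using one_minus_mult_power_nonzero[OF q q, of n] by simp
  \<comment> \<open>From (1 - q^m) / (q;q)_m = 1 / (q;q)_(m-1); the term j = n + 1 is the same for
    \<open>w\<close> and \<open>w * q\<close> and cancels.\<close>
  have rec: "e w (Suc n) - w * e w n = e (w * q) (Suc n)" for w n
  proof -
    have "e w (Suc n) - e (w * q) (Suc n)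
        = (\<Sum>j\<le>n. f j * (w ^ (Suc n - j) * (1 - q ^ (Suc n - j)) / qpoch q q (Suc n - j)))"
    proof -
      have "e w (Suc n) - e (w * q) (Suc n)
          = (\<Sum>j\<le>Suc n. f j * w ^ (Suc n - j) / qpoch q q (Suc n - j)
              - f j * (w * q) ^ (Suc n - j) / qpoch q q (Suc n - j))"
        unfolding e_def by (rule sum_subtractf[symmetric])
      also have "\<dots> = (\<Sum>j\<le>n. f j * w ^ (Suc n - j) / qpoch q q (Suc n - j)
              - f j * (w * q) ^ (Suc n - j) / qpoch q q (Suc n - j))"
        by (simp add: atMost_Suc)
      also have "\<dots> = (\<Sum>j\<le>n. f j * (w ^ (Suc n - j) * (1 - q ^ (Suc n - j)) / qpoch q q (Suc n - j)))"
        by (intro sum.cong refl) (simp only: power_mult_distrib right_diff_distrib diff_divide_distrib mult_1_right times_divide_eq_right mult.assoc)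
      finally show ?thesis .
    qed
    also have "\<dots> = (\<Sum>j\<le>n. w * (f j * w ^ (n - j) / qpoch q q (n - j)))"
    proof (intro sum.cong refl)
      fix j assume "j \<in> {..n}"
      then have "Suc n - j = Suc (n - j)" by auto
      then show "f j * (w ^ (Suc n - j) * (1 - q ^ (Suc n - j)) / qpoch q q (Suc n - j))
          = w * (f j * w ^ (n - j) / qpoch q q (n - j))"
        using nz[of "n - j"] nz'[of "n - j"] unfolding qpoch_q_Suc by (simp add: qpoch_q_Suc)
    qed
    finally show ?thesis by (simp add: e_def sum_distrib_left algebra_simps)
  qed
  \<comment> \<open>Since f j is O(4^(-j)) and |w|^(n-j) is at most 2^(-(n-j)), each term is
    O(2^(-n) 2^(-j)); the spare 2^(-j) bounds the sum over j by 2 instead of n + 1. This is why the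
    hypothesis carries the weight 4^n.\<close>
  have small: "\<exists>C. \<forall>n. norm (e w n) \<le> C * (1/2) ^ n" if w: "norm w \<le> 1/2" for w
  proof -
    obtain K where K: "K > 0" "\<And>n. norm (inverse (qpoch q q n)) \<le> K"
      by (rule qpoch_bounds[OF q q]) (rule that)
    obtain C where C: "\<And>n. norm (norm (f n) * 4 ^ n) \<le> C"
      by (rule BseqE[OF summable_imp_Bseq[OF f]]) (rule that, blast)
    have C': "norm (f n) \<le> C * (1/4)^n" for n
      using C[of n] by (simp add: power_one_over pos_le_divide_eq)
    have C0: "0 \<le> C" using order_trans[OF norm_ge_zero C'[of 0]] by simp
    have "norm (e w n) \<le> 2 * C * K * (1/2) ^ n" for n
    proof -
      have "norm (e w n) \<le> (\<Sum>j\<le>n. C * K * (1/2) ^ n * (1/2) ^ j)"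
        unfolding e_def
      proof (intro order_trans[OF norm_sum sum_mono])
        fix j assume j: "j \<in> {..n}"
        have "norm (f j * w ^ (n - j) / qpoch q q (n - j))
            = norm (f j) * norm w ^ (n - j) * norm (inverse (qpoch q q (n - j)))"
          by (simp add: divide_inverse norm_mult norm_power)
        also have "\<dots> \<le> (C * (1/4) ^ j) * (1/2) ^ (n - j) * K"
          using w C0 by (intro mult_mono C' K power_mono) auto
        also have "(1/4::real) ^ j = (1/2) ^ j * (1/2) ^ j"
          by (simp add: power_mult_distrib[symmetric])
        also have "C * ((1/2) ^ j * (1/2) ^ j) * (1/2) ^ (n - j) * K
            = C * K * ((1/2) ^ (n - j) * (1/2) ^ j) * (1/2) ^ j"
          by (simp only: mult_ac)
        also have "(1/2::real) ^ (n - j) * (1/2) ^ j = (1/2) ^ n"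
          using j by (metis atMost_iff le_add_diff_inverse2 power_add)
        finally show "norm (f j * w ^ (n - j) / qpoch q q (n - j)) \<le> C * K * (1/2) ^ n * (1/2) ^ j" .
      qed
      also have "\<dots> = C * K * (1/2) ^ n * (\<Sum>j\<le>n. (1/2) ^ j)"
        by (simp add: sum_distrib_left)
      also have "\<dots> \<le> C * K * (1/2) ^ n * 2"
        using C0 K by (intro mult_left_mono) (auto simp: sum_gp0)
      finally show ?thesis by (simp only: mult_ac)
    qed
    then show ?thesis by blast
  qed
  \<comment> \<open>Induction on the number of replacements of \<open>w\<close> by
    \<open>w * q\<close> until it is small. By \<open>rec\<close>, convergence to 0 passes down to
    \<open>w * q\<close>, and the geometric bound passes back up.\<close>
  have main: "\<exists>C \<rho>. 0 < \<rho> \<and> \<rho> < 1 \<and> (\<forall>n. norm (e w n) \<le> C * \<rho> ^ n)"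
    if "norm (w * q ^ N) \<le> 1/2" "e w \<longlonglongrightarrow> 0" for w N
    using that
  proof (induction N arbitrary: w)
    case 0
    then obtain C where "\<forall>n. norm (e w n) \<le> C * (1/2) ^ n" using small by auto
    then show ?case by (intro exI[of _ C] exI[of _ "1/2"]) auto
  next
    case (Suc N)
    have "(\<lambda>n. e w (Suc n) - w * e w n) \<longlonglongrightarrow> 0 - w * 0"
      by (intro tendsto_intros Suc.prems LIMSEQ_Suc)
    then have "e (w * q) \<longlonglongrightarrow> 0"
      unfolding rec by (simp add: filterlim_sequentially_Suc)
    moreover have "norm (w * q * q ^ N) \<le> 1/2"
      using Suc.prems by (simp add: mult_ac)
    ultimately obtain C \<rho> where C: "0 < \<rho>" "\<rho> < 1" "\<And>n. norm (e (w * q) n) \<le> C * \<rho> ^ n"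
      using Suc.IH by blast
    have "norm (e w (Suc n) - w * e w n) \<le> C * \<rho> * \<rho> ^ n" for n
      unfolding rec using C(3)[of "Suc n"] by (simp add: mult_ac)
    then show ?case
      by (rule geometric_bound_from_recurrence[OF Suc.prems(2) C(1,2)]) (intro exI conjI allI, assumption+)
  qed
  have "(\<lambda>N. norm (w * q ^ N)) \<longlonglongrightarrow> norm (w * 0)"
    using q by (intro tendsto_intros LIMSEQ_power_zero)
  then have "eventually (\<lambda>N. norm (w * q ^ N) < 1/2) sequentially"
    by (rule order_tendstoD) simp
  then obtain N where "norm (w * q ^ N) < 1/2"
    by (auto simp: eventually_sequentially)
  then have "norm (w * q ^ N) \<le> 1/2" by simp
  moreover have "e w \<longlonglongrightarrow> 0" unfolding e_def by (rule lim)
  ultimately have "\<exists>C \<rho>. 0 < \<rho> \<and> \<rho> < 1 \<and> (\<forall>n. norm (e w n) \<le> C * \<rho> ^ n)"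
    by (rule main)
  then show ?thesis unfolding e_def by (elim exE conjE) (rule that, auto)
qed

subsection \<open>Rogers-Szego polynomials\<close>

lemma qpoch_pos:
  fixes q :: real
  assumes "0 \<le> q" "q < 1"
  shows "0 < qpoch q q n"
  unfolding qpoch_def
proof (intro prod_pos ballI)
  fix j
  have "q * q ^ j \<le> q * 1"
    using assms by (intro mult_left_mono power_le_one) auto
  then show "0 < 1 - q * q ^ j" using assms by simp
qed

lemma qbinomial_nonneg:
  fixes q :: real
  assumes "0 \<le> q" "q < 1"
  shows "0 \<le> qbinomial q n j"
  unfolding qbinomial_def using qpoch_pos[OF assms] by (simp add: less_imp_le)

lemma qbinomial_symmetric: "j \<le> n \<Longrightarrow> qbinomial q n (n - j) = qbinomial q n j"
  by (simp add: qbinomial_def mult.commute)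

lemma of_real_qbinomial: "of_real (qbinomial q n j) = (qbinomial (of_real q) n j :: 'a::real_normed_field)"
  by (simp add: qbinomial_def of_real_qpoch)

lemma qbinomial_bounded:
  fixes q :: "'a::{real_normed_field,banach}"
  assumes "norm q < 1"
  obtains K where "K > 0" "\<And>n j. norm (qbinomial q n j) \<le> K"
proof -
  obtain K where K: "K > 0" "\<And>n. norm (qpoch q q n) \<le> K" "\<And>n. norm (inverse (qpoch q q n)) \<le> K"
    by (rule qpoch_bounds[OF assms assms]) (rule that)
  have "norm (qbinomial q n j) \<le> K * (K * K)" for n j
  proof -
    have "norm (qbinomial q n j)
        = norm (qpoch q q n) * (norm (inverse (qpoch q q j)) * norm (inverse (qpoch q q (n - j))))"
      by (simp add: qbinomial_def divide_inverse norm_mult)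
    also have "\<dots> \<le> K * (K * K)"
      using K(1) by (intro mult_mono K) auto
    finally show ?thesis .
  qed
  then show ?thesis using K(1) by (intro that[of "K * (K * K)"]) auto
qed

text \<open>Reversed so that the summation index is the power of \<open>y\<close>, the argument that
  will carry the integration variable.\<close>

lemma rogers_szego_altdef:
  "rogers_szego q n x y = (\<Sum>j\<le>n. of_real (qbinomial q n j) * x ^ (n - j) * y ^ j)"
  unfolding rogers_szego_def
  by (rule sum.reindex_bij_witness[of _ "\<lambda>j. n - j" "\<lambda>j. n - j"]) (auto simp: qbinomial_symmetric)

text \<open>The \<open>q\<close>-binomials are bounded uniformly in both indices, and the remaining
  sum is dominated by a geometric series in \<open>r\<close>.\<close>

lemma norm_rogers_szego_le:
  fixes q r :: real
  assumes "\<bar>q\<bar> < 1" "0 \<le> r" "r < 1"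
  obtains K where "K > 0" "\<And>n x y. norm x \<le> r * norm y \<Longrightarrow> norm (rogers_szego q n x y) \<le> K * norm y ^ n"
proof -
  obtain K where K: "K > 0" "\<And>n j. norm (qbinomial q n j) \<le> K"
    by (rule qbinomial_bounded[of q]) (use assms in simp, rule that)
  have "norm (rogers_szego q n x y) \<le> K * (1 / (1 - r)) * norm y ^ n"
    if xy: "norm x \<le> r * norm y" for n and x y :: complex
  proof -
    have "norm (rogers_szego q n x y) \<le> (\<Sum>j\<le>n. K * norm y ^ n * r ^ j)"
      unfolding rogers_szego_def
    proof (intro order_trans[OF norm_sum sum_mono])
      fix j assume j: "j \<in> {..n}"
      have "norm (of_real (qbinomial q n j) * x ^ j * y ^ (n - j))
          = norm (qbinomial q n j) * norm x ^ j * norm y ^ (n - j)"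
        by (simp add: norm_mult norm_power)
      also have "\<dots> \<le> K * (r * norm y) ^ j * norm y ^ (n - j)"
        using K(1) xy assms(2) by (intro mult_mono K power_mono) auto
      also have "\<dots> = K * (norm y ^ (n - j) * norm y ^ j) * r ^ j"
        by (simp only: power_mult_distrib mult_ac)
      also have "norm y ^ (n - j) * norm y ^ j = norm y ^ n"
        using j by (metis atMost_iff le_add_diff_inverse2 power_add)
      finally show "norm (of_real (qbinomial q n j) * x ^ j * y ^ (n - j)) \<le> K * norm y ^ n * r ^ j" .
    qed
    also have "\<dots> = K * norm y ^ n * (\<Sum>j\<le>n. r ^ j)"
      by (simp add: sum_distrib_left)
    also have "\<dots> \<le> K * norm y ^ n * (1 / (1 - r))"
    proof (intro mult_left_mono)
      show "(\<Sum>j\<le>n. r ^ j) \<le> 1 / (1 - r)"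
        using assms sum_gp0[of r n] by (simp add: divide_right_mono)
    qed (use K in auto)
    finally show ?thesis by (simp only: mult_ac)
  qed
  then show ?thesis
    using K(1) assms(3) by (intro that[of "K * (1 / (1 - r))"]) auto
qed

text \<open>When the first argument is a nonnegative multiple of the second, all terms have the same
  phase, so the sum is at least as large as its term j = 0.\<close>

lemma norm_rogers_szego_ge:
  fixes q c :: real
  assumes "0 \<le> q" "q < 1" "0 \<le> c"
  shows "norm y ^ n \<le> norm (rogers_szego q n (of_real c * y) y)"
proof -
  define s where "s = (\<Sum>j\<le>n. qbinomial q n j * c ^ j)"
  have "rogers_szego q n (of_real c * y) y = (\<Sum>j\<le>n. of_real (qbinomial q n j * c ^ j) * y ^ n)"
    unfolding rogers_szego_def
  proof (intro sum.cong refl)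
    fix j assume "j \<in> {..n}"
    then have "y ^ n = y ^ j * y ^ (n - j)"
      by (metis atMost_iff le_add_diff_inverse power_add)
    then show "of_real (qbinomial q n j) * (of_real c * y) ^ j * y ^ (n - j)
        = of_real (qbinomial q n j * c ^ j) * y ^ n"
      by (simp add: power_mult_distrib)
  qed
  also have "\<dots> = of_real s * y ^ n"
    by (simp add: s_def sum_distrib_right)
  finally have eq: "norm (rogers_szego q n (of_real c * y) y) = \<bar>s\<bar> * norm y ^ n"
    by (simp add: norm_mult norm_power)
  have "qbinomial q n 0 * c ^ 0 \<le> s"
    unfolding s_def using qbinomial_nonneg[OF assms(1,2)] assms(3)
    by (intro member_le_sum) auto
  then have "1 \<le> s"
    using qpoch_pos[OF assms(1,2), of n] by (simp add: qbinomial_def)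
  then have "1 * norm y ^ n \<le> \<bar>s\<bar> * norm y ^ n"
    by (intro mult_right_mono) auto
  then show ?thesis by (simp add: eq)
qed

section \<open>Gaussian integrals of Rogers-Szego polynomials\<close>

lemma has_bochner_integral_gaussian_monomial:
  fixes m k :: real
  shows "has_bochner_integral lborel
     (\<lambda>\<theta>. of_real (exp (- (\<theta> ^ 2) + 2 * m * \<theta>))
        * (exp (2 * of_real k * \<i> * of_real \<theta>) ^ a * exp (- 2 * \<i> * of_real k * of_real \<theta>) ^ b))
     (of_real (sqrt pi * exp (m ^ 2))
        * (exp (2 * of_real m * of_real k * \<i>) ^ a * exp (- 2 * of_real m * of_real k * \<i>) ^ b)
        * of_real (exp (- ((k * (real a - real b)) ^ 2))))"
proof -
  have e: "exp (2 * of_real k * \<i> * of_real \<theta>) ^ a * exp (- 2 * \<i> * of_real k * of_real \<theta>) ^ b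
      = exp (2 * \<i> * of_real (k * (real a - real b) * \<theta>))" for \<theta> :: real
    by (simp add: exp_of_nat_mult[symmetric] exp_add[symmetric] algebra_simps)
  have e': "exp (2 * of_real m * of_real k * \<i>) ^ a * exp (- 2 * of_real m * of_real k * \<i>) ^ b
      = exp (2 * \<i> * of_real (m * (k * (real a - real b))))"
    by (simp add: exp_of_nat_mult[symmetric] exp_add[symmetric] algebra_simps)
  show ?thesis
    unfolding e e' using has_bochner_integral_gaussian_exp[of m "k * (real a - real b)"] by simp
qed

lemma real_choose_2: "2 * real (n choose 2) = real n * (real n - 1)"
  by (induction n) (simp_all add: Suc_choose_2 algebra_simps)

text \<open>Balances the exponents of \<open>q\<close> when the expansion index is shifted to i = n
  + l.\<close>

lemma choose_2_add: "(Suc (n + l) choose 2) + (n choose 2) = (n + l) * n + (l choose 2) + l"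
  by (induction n) (simp_all add: Suc_choose_2)

text \<open>The Gaussian factor is q^((a-b)^2/2); the half-integer power q^((a+b)/2) completes its
  exponent to an integer. The mixed term -ab then appears as (q^(-b))^a, the argument needed in the
  \<open>q\<close>-binomial theorem.\<close>

lemma gaussian_exponent:
  fixes k q :: real
  assumes q: "q = exp (- 2 * k ^ 2)"
  shows "exp (- ((k * (real a - real b)) ^ 2)) * sqrt q ^ (a + b)
    = q ^ (Suc b choose 2) * (q ^ a * q ^ (a choose 2)) * inverse q ^ (b * a)"
proof -
  have s: "sqrt q = exp (- (k ^ 2))"
    unfolding q by (rule real_sqrt_unique) (simp_all add: exp_double[symmetric] power2_eq_square exp_add[symmetric])
  have i: "inverse q = exp (2 * k ^ 2)" by (simp add: q exp_minus)
  have "exp (- ((k * (real a - real b)) ^ 2)) * sqrt q ^ (a + b)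
     = exp (- (k ^ 2) * ((real a - real b) ^ 2 + (real a + real b)))"
    unfolding s power_mult_distrib
    by (simp add: exp_of_nat_mult[symmetric] exp_add[symmetric] algebra_simps)
  also have "(real a - real b) ^ 2 + (real a + real b)
     = 2 * real (Suc b choose 2) + 2 * real a + 2 * real (a choose 2) - 2 * real (b * a)"
    unfolding real_choose_2 by (simp add: power2_eq_square algebra_simps)
  also have "exp (- (k ^ 2) * \<dots>)
     = q ^ (Suc b choose 2) * (q ^ a * q ^ (a choose 2)) * inverse q ^ (b * a)"
    unfolding i unfolding q by (simp only: exp_of_nat_mult[symmetric] exp_add[symmetric]) (simp add: algebra_simps)
  finally show ?thesis .
qed

text \<open>Integrating each monomial of the polynomial leaves a sum over j that is the
  \<open>q\<close>-binomial sum at v = q^(-i).\<close>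

lemma has_bochner_integral_gaussian_rogers_szego_power:
  fixes m k q :: real and z :: complex
  defines "T \<equiv> exp (2 * of_real m * of_real k * \<i>)" and "T' \<equiv> exp (- 2 * of_real m * of_real k * \<i>)"
  assumes q: "q = exp (- 2 * k ^ 2)" and q1: "q < 1"
  shows "has_bochner_integral lborel
     (\<lambda>\<theta>. of_real (exp (- (\<theta> ^ 2) + 2 * m * \<theta>))
        * (z * of_real (sqrt q) * exp (- 2 * \<i> * of_real k * of_real \<theta>)) ^ i
        * rogers_szego q n (- of_real q * T) (of_real (sqrt q) * exp (2 * of_real k * \<i> * of_real \<theta>)))
     (of_real (sqrt pi * exp (m ^ 2)) * (z * T') ^ i * (- of_real q * T) ^ n
        * of_real q ^ (Suc i choose 2) * qpoch (inverse (of_real q) ^ i) (of_real q) n)"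
proof -
  define Q S :: complex where "Q = of_real q" and "S = of_real (sqrt q)"
  define c0 :: complex where "c0 = of_real (sqrt pi * exp (m ^ 2))"
  define G :: "real \<Rightarrow> complex" where "G \<theta> = of_real (exp (- (\<theta> ^ 2) + 2 * m * \<theta>))" for \<theta>
  define X :: "real \<Rightarrow> complex" where "X \<theta> = exp (2 * of_real k * \<i> * of_real \<theta>)" for \<theta>
  define X' :: "real \<Rightarrow> complex" where "X' \<theta> = exp (- 2 * \<i> * of_real k * of_real \<theta>)" for \<theta>
  have Q1: "norm Q < 1" using q1 by (simp add: Q_def q)
  have E: "of_real (exp (- ((k * (real a - real b)) ^ 2))) * S ^ (a + b)
      = Q ^ (Suc b choose 2) * (Q ^ a * Q ^ (a choose 2)) * inverse Q ^ (b * a)" for a b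
    using arg_cong[OF gaussian_exponent[OF q, of a b], of complex_of_real]
    by (simp only: S_def Q_def of_real_mult of_real_power of_real_inverse)
  have "has_bochner_integral lborel
     (\<lambda>\<theta>. \<Sum>j\<le>n. (qbinomial Q n j * (- Q * T) ^ (n - j) * S ^ j * (z * S) ^ i) * (G \<theta> * (X \<theta> ^ j * X' \<theta> ^ i)))
     (\<Sum>j\<le>n. (qbinomial Q n j * (- Q * T) ^ (n - j) * S ^ j * (z * S) ^ i)
       * (c0 * (T ^ j * T' ^ i) * of_real (exp (- ((k * (real j - real i)) ^ 2)))))"
    unfolding G_def X_def X'_def T_def T'_def c0_def
    by (intro has_bochner_integral_sum has_bochner_integral_mult_right has_bochner_integral_gaussian_monomial)
  also have "(\<lambda>\<theta>. \<Sum>j\<le>n. (qbinomial Q n j * (- Q * T) ^ (n - j) * S ^ j * (z * S) ^ i) * (G \<theta> * (X \<theta> ^ j * X' \<theta> ^ i)))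
     = (\<lambda>\<theta>. G \<theta> * (z * S * X' \<theta>) ^ i * rogers_szego q n (- Q * T) (S * X \<theta>))"
    unfolding rogers_szego_altdef sum_distrib_left of_real_qbinomial Q_def[symmetric] power_mult_distrib
    by (simp only: mult_ac)
  also have "(\<Sum>j\<le>n. (qbinomial Q n j * (- Q * T) ^ (n - j) * S ^ j * (z * S) ^ i)
       * (c0 * (T ^ j * T' ^ i) * of_real (exp (- ((k * (real j - real i)) ^ 2)))))
     = (\<Sum>j\<le>n. (c0 * (z * T') ^ i * (- Q * T) ^ n * Q ^ (Suc i choose 2))
         * (qbinomial Q n j * (- 1) ^ j * Q ^ (j choose 2) * (inverse Q ^ i) ^ j))"
  proof (intro sum.cong refl)
    fix j assume "j \<in> {..n}"
    then have n: "(- Q * T) ^ n = (- Q * T) ^ (n - j) * ((- 1) ^ j * Q ^ j * T ^ j)"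
      unfolding power_mult_distrib[symmetric] by (simp add: power_add[symmetric])
    have "(qbinomial Q n j * (- Q * T) ^ (n - j) * S ^ j * (z * S) ^ i)
       * (c0 * (T ^ j * T' ^ i) * of_real (exp (- ((k * (real j - real i)) ^ 2))))
       = c0 * (z * T') ^ i * (- Q * T) ^ (n - j) * T ^ j * qbinomial Q n j
         * (of_real (exp (- ((k * (real j - real i)) ^ 2))) * S ^ (j + i))"
      by (simp only: power_mult_distrib power_add mult_ac)
    \<comment> \<open>Two signs (-1)^j are needed, one to complete (-QT)^n and one for the
      \<open>q\<close>-binomial sum; the last factor compensates for inserting both.\<close>
    also have "\<dots> = c0 * (z * T') ^ i * ((- Q * T) ^ (n - j) * ((- 1) ^ j * Q ^ j * T ^ j)) * Q ^ (Suc i choose 2)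
         * (qbinomial Q n j * (- 1) ^ j * Q ^ (j choose 2) * (inverse Q ^ i) ^ j) * ((- 1) ^ j * (- 1) ^ j)"
      unfolding E power_mult by (simp add: mult_ac flip: power_mult_distrib)
    finally show "(qbinomial Q n j * (- Q * T) ^ (n - j) * S ^ j * (z * S) ^ i)
       * (c0 * (T ^ j * T' ^ i) * of_real (exp (- ((k * (real j - real i)) ^ 2))))
       = (c0 * (z * T') ^ i * (- Q * T) ^ n * Q ^ (Suc i choose 2))
         * (qbinomial Q n j * (- 1) ^ j * Q ^ (j choose 2) * (inverse Q ^ i) ^ j)"
      unfolding n[symmetric] by (simp flip: power_mult_distrib)
  qed
  also have "\<dots> = c0 * (z * T') ^ i * (- Q * T) ^ n * Q ^ (Suc i choose 2) * qpoch (inverse Q ^ i) Q n"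
    unfolding sum_distrib_left[symmetric] q_binomial_theorem[OF Q1] ..
  finally show ?thesis
    unfolding G_def X_def X'_def Q_def S_def c0_def .
qed

text \<open>Expand the reciprocal product by Euler's first series and integrate termwise. The terms
  i < n vanish, and the terms i = n + l form Euler's second series, so \<open>n\<close> survives
  only in (zq)^n.\<close>

lemma has_bochner_integral_gaussian_rogers_szego:
  fixes m k q :: real and z :: complex
  defines "T \<equiv> exp (2 * of_real m * of_real k * \<i>)" and "T' \<equiv> exp (- 2 * of_real m * of_real k * \<i>)"
  assumes q: "q = exp (- 2 * k ^ 2)" and q1: "q < 1" and z: "norm (z * of_real (sqrt q)) < 1"
  shows "has_bochner_integral lborel
     (\<lambda>\<theta>. of_real (exp (- (\<theta> ^ 2) + 2 * m * \<theta>))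
        / qpoch_inf (z * of_real (sqrt q) * exp (- 2 * \<i> * of_real k * of_real \<theta>)) (of_real q)
        * rogers_szego q n (- of_real q * T) (of_real (sqrt q) * exp (2 * of_real k * \<i> * of_real \<theta>)))
     (of_real (sqrt pi * exp (m ^ 2)) * (z * of_real q) ^ n * qpoch_inf (- z * of_real q * T') (of_real q))"
proof -
  define Q S :: complex where "Q = of_real q" and "S = of_real (sqrt q)"
  define c0 :: complex where "c0 = of_real (sqrt pi * exp (m ^ 2))"
  define g where "g \<theta> = exp (- (\<theta> ^ 2) + 2 * m * \<theta>)" for \<theta>
  define U where "U \<theta> = z * S * exp (- 2 * \<i> * of_real k * of_real \<theta>)" for \<theta>
  define R where "R \<theta> = rogers_szego q n (- Q * T) (S * exp (2 * of_real k * \<i> * of_real \<theta>))" for \<theta>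
  have q0: "0 < q" by (simp add: q)
  have Q1: "norm Q < 1" and Q0: "Q \<noteq> 0" using q1 q0 by (simp_all add: Q_def)
  have nz: "qpoch Q Q n \<noteq> 0" for n by (rule qpoch_nonzero[OF Q1 Q1])
  have nT: "norm T = 1" by (simp add: T_def)
  have TT': "T * T' = 1" by (simp add: T_def T'_def flip: exp_add)
  have nU: "norm (U \<theta>) = norm (z * S)" for \<theta>
    by (simp add: U_def norm_mult)
  have U1: "norm (U \<theta>) < 1" for \<theta> unfolding nU using z by (simp add: S_def)
  have g: "integrable lborel g"
  proof -
    have "integrable lborel (\<lambda>\<theta>. complex_of_real (g \<theta>))"
      using has_bochner_integral_gaussian_exp[of m 0] by (simp add: has_bochner_integral_iff g_def)
    from integrable_norm[OF this] show ?thesis by (simp add: g_def[abs_def])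
  qed
  \<comment> \<open>The ratio sqrt q is that of the norms q and sqrt q of the two arguments of the
    polynomial.\<close>
  obtain K where K: "K > 0"
    "\<And>n x y. norm x \<le> sqrt q * norm y \<Longrightarrow> norm (rogers_szego q n x y) \<le> K * norm y ^ n"
    by (rule norm_rogers_szego_le[of q "sqrt q"]) (use q0 q1 in simp, use q0 in simp, use q1 in simp, rule that)
  have R: "norm (R \<theta>) \<le> K * sqrt q ^ n" for \<theta>
  proof -
    have "norm (R \<theta>) \<le> K * norm (S * exp (2 * of_real k * \<i> * of_real \<theta>)) ^ n"
      unfolding R_def using q0 by (intro K) (simp add: norm_mult nT Q_def S_def)
    then show ?thesis using q0 by (simp add: norm_mult S_def)
  qed
  define f where "f i \<theta> = of_real (g \<theta>) * U \<theta> ^ i * R \<theta> * inverse (qpoch Q Q i)" for i \<theta>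
  define I where "I i = c0 * (z * T') ^ i * (- Q * T) ^ n * Q ^ (Suc i choose 2)
    * qpoch (inverse Q ^ i) Q n * inverse (qpoch Q Q i)" for i
  have fI: "has_bochner_integral lborel (f i) (I i)" for i
    unfolding f_def[abs_def] I_def g_def U_def R_def c0_def Q_def S_def T_def T'_def
    by (intro has_bochner_integral_mult_left has_bochner_integral_gaussian_rogers_szego_power q q1)
  define B where "B i = norm ((z * S) ^ i / qpoch Q Q i) * (K * sqrt q ^ n)" for i
  have B: "summable B"
    unfolding B_def using z by (intro summable_mult2 summable_inverse_qpoch Q1) (simp add: S_def)
  have bound: "norm (f i \<theta>) \<le> B i * g \<theta>" for i \<theta>
  proof -
    have "norm (f i \<theta>) = g \<theta> * norm ((z * S) ^ i / qpoch Q Q i) * norm (R \<theta>)"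
      by (simp add: f_def norm_mult norm_power nU[unfolded norm_mult] g_def norm_divide divide_inverse norm_inverse)
    also have "\<dots> \<le> g \<theta> * norm ((z * S) ^ i / qpoch Q Q i) * (K * sqrt q ^ n)"
      by (intro mult_left_mono R) (simp add: g_def)
    finally show ?thesis by (simp add: B_def mult_ac)
  qed
  note sums = has_bochner_integral_suminf[OF fI g B bound]
  have "(\<Sum>i. f i \<theta>) = of_real (g \<theta>) / qpoch_inf (U \<theta>) Q * R \<theta>" for \<theta>
  proof -
    have "(\<Sum>i. f i \<theta>) = (\<Sum>i. (of_real (g \<theta>) * R \<theta>) * (U \<theta> ^ i / qpoch Q Q i))"
      by (simp add: f_def divide_inverse mult_ac)
    also have "\<dots> = (of_real (g \<theta>) * R \<theta>) * inverse (qpoch_inf (U \<theta>) Q)"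
      unfolding qpoch_inf_inverse_series[OF Q1 U1, symmetric]
      by (rule suminf_mult[OF summable_norm_cancel[OF summable_inverse_qpoch[OF Q1 U1]]])
    finally show ?thesis by (simp add: divide_inverse mult_ac)
  qed
  moreover have "(\<Sum>i. I i) = c0 * (z * Q) ^ n * qpoch_inf (- z * Q * T') Q"
  proof -
    have I0: "I i = 0" if "i < n" for i
      unfolding I_def qpoch_inverse_power_eq_0[OF Q0 that] by simp
    have Il: "I (l + n) = c0 * (z * Q) ^ n * (Q ^ (l choose 2) * (z * Q * T') ^ l / qpoch Q Q l)" for l
    proof -
      \<comment> \<open>The power used in \<open>qpoch_inverse_power\<close> to clear denominators;
        \<open>choose_2_add\<close> extracts the same power from the Gaussian factor, so it
        cancels.\<close>
      define P where "P = Q ^ ((n + l) * n)"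
      have P0: "P \<noteq> 0" using Q0 by (simp add: P_def)
      have e1: "qpoch (inverse Q ^ (n + l)) Q n * qpoch Q Q l * P
          = (- 1) ^ n * Q ^ (n choose 2) * qpoch Q Q (n + l)"
        using qpoch_inverse_power[OF Q0, of n "n + l"] by (simp add: P_def)
      have e2: "Q ^ (Suc (n + l) choose 2) * Q ^ (n choose 2) = P * Q ^ (l choose 2) * Q ^ l"
        unfolding P_def power_add[symmetric] choose_2_add ..
      have e3: "qpoch (inverse Q ^ (n + l)) Q n * inverse (qpoch Q Q (n + l))
          = (- 1) ^ n * Q ^ (n choose 2) / (qpoch Q Q l * P)"
        using e1 nz P0 by (simp add: field_simps)
      have "I (l + n) = c0 * (z * T') ^ (n + l) * (- Q * T) ^ n * Q ^ (Suc (n + l) choose 2)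
          * (qpoch (inverse Q ^ (n + l)) Q n * inverse (qpoch Q Q (n + l)))"
        by (simp only: I_def add.commute[of l n] mult.assoc)
      also have "\<dots> = c0 * (z * T') ^ (n + l) * ((- 1) ^ n * Q ^ n * T ^ n) * (- 1) ^ n
          * (Q ^ (Suc (n + l) choose 2) * Q ^ (n choose 2)) / (qpoch Q Q l * P)"
        unfolding e3 power_mult_distrib[symmetric] by (simp add: mult_ac)
      also have "\<dots> = c0 * z ^ n * z ^ l * T' ^ l * (T * T') ^ n * ((- 1) * (- 1)) ^ n * Q ^ n
          * (P * Q ^ (l choose 2) * Q ^ l) / (qpoch Q Q l * P)"
        unfolding e2 by (simp only: power_mult_distrib power_add mult_ac)
      also have "\<dots> = c0 * (z * Q) ^ n * (Q ^ (l choose 2) * (z * Q * T') ^ l / qpoch Q Q l)"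
        using P0 unfolding TT' by (simp add: power_mult_distrib)
      finally show ?thesis .
    qed
    have "(\<Sum>i. I i) = (\<Sum>l. I (l + n)) + (\<Sum>i<n. I i)"
      by (rule suminf_split_initial_segment[OF sums(2)])
    also have "\<dots> = (\<Sum>l. c0 * (z * Q) ^ n * (Q ^ (l choose 2) * (z * Q * T') ^ l / qpoch Q Q l))"
      unfolding Il by (simp add: I0)
    also have "\<dots> = c0 * (z * Q) ^ n * qpoch_inf (- z * Q * T') Q"
      using suminf_mult[OF qpoch_inf_series(2)[OF Q1, of "z * Q * T'"]]
      by (simp add: qpoch_inf_series(1)[OF Q1])
    finally show ?thesis .
  qed
  ultimately show ?thesis
    using sums(1) by (simp add: g_def U_def R_def c0_def Q_def S_def)
qed

subsection \<open>\<open>q\<close>-Laguerre polynomials\<close>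

text \<open>The right-hand side depends on \<open>u\<close> only through its norm, so it bounds the
  reciprocal uniformly on a circle.\<close>

lemma norm_inverse_qpoch_inf_le:
  fixes q u :: "'a::{real_normed_field,banach}"
  assumes "norm q < 1" "norm u < 1"
  shows "norm (inverse (qpoch_inf u q)) \<le> (\<Sum>n. norm (u ^ n / qpoch q q n))"
  unfolding qpoch_inf_inverse_series[OF assms, symmetric]
  by (rule summable_norm[OF summable_inverse_qpoch[OF assms]])

text \<open>The part of the j-th summand of L_n/(q;q)_n that is independent of n. What remains is
  y^(n-j)/(q;q)_(n-j), so L_n/(q;q)_n is a convolution.\<close>

definition q_laguerre_coeff :: "real \<Rightarrow> real \<Rightarrow> complex \<Rightarrow> nat \<Rightarrow> complex" where
  "q_laguerre_coeff q \<alpha> x j =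
     of_real (q powr (real j ^ 2 + real j * \<alpha>) / (qpoch (q powr (\<alpha> + 1)) q j * qpoch q q j)) * (- x) ^ j"

lemma q_laguerre_div_qpoch:
  assumes "0 < q" "q < 1"
  shows "q_laguerre q \<alpha> n x y / of_real (qpoch q q n)
    = (\<Sum>j\<le>n. q_laguerre_coeff q \<alpha> x j * y ^ (n - j) / qpoch (of_real q) (of_real q) (n - j))"
  unfolding q_laguerre_def sum_divide_distrib
proof (intro sum.cong refl)
  fix j
  have "complex_of_real (qpoch q q n) \<noteq> 0"
    using qpoch_pos[of q n] assms by simp
  then show "of_real (qbinomial q n j * q powr (real j ^ 2 + real j * \<alpha>) / qpoch (q powr (\<alpha> + 1)) q j)
        * (- x) ^ j * y ^ (n - j) / of_real (qpoch q q n)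
      = q_laguerre_coeff q \<alpha> x j * y ^ (n - j) / qpoch (of_real q) (of_real q) (n - j)"
    by (simp add: q_laguerre_coeff_def qbinomial_def of_real_qpoch[symmetric] mult_ac)
qed

text \<open>As j^2 + j \<alpha> = 2 (j choose 2) + j (\<alpha> + 1), the real exponents reduce to
  natural powers of q^2 and of q^(\<alpha>+1).\<close>

lemma powr_square_add:
  fixes q :: real
  assumes "0 < q"
  shows "q powr (real j ^ 2 + real j * \<alpha>) = (q ^ 2) ^ (j choose 2) * (q powr (\<alpha> + 1)) ^ j"
proof -
  have "real j ^ 2 + real j * \<alpha> = real (2 * (j choose 2)) + real j * (\<alpha> + 1)"
    using real_choose_2[of j] by (simp add: power2_eq_square algebra_simps)
  also have "q powr \<dots> = q ^ (2 * (j choose 2)) * q powr (real j * (\<alpha> + 1))"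
    using assms by (simp only: powr_add powr_realpow)
  also have "q powr (real j * (\<alpha> + 1)) = (q powr (\<alpha> + 1)) ^ j"
    using assms powr_realpow[of "q powr (\<alpha> + 1)" j] by (simp add: powr_powr mult.commute)
  finally show ?thesis by (simp add: power_mult)
qed

lemma powr_less_one_base:
  fixes q :: real
  assumes "0 < q" "q < 1" "0 < a"
  shows "q powr a < 1"
  using powr_less_mono2[of a q 1] assms by simp

lemma summable_q_laguerre_coeff:
  fixes t x :: complex
  assumes "0 < q" "q < 1" "\<alpha> > -1"
  shows "summable (\<lambda>j. norm (q_laguerre_coeff q \<alpha> x j * t ^ j))"
proof -
  define A where "A = q powr (\<alpha> + 1)"
  have A: "0 < A" "A < 1"
    using assms powr_less_one_base[of q "\<alpha> + 1"] by (simp_all add: A_def)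
  obtain K1 where K1: "\<And>n. norm (inverse (qpoch A q n)) \<le> K1"
    by (rule qpoch_bounds[of q A]) (use assms A in simp, use A in simp, rule that)
  obtain K2 where K2: "K2 > 0" "\<And>n. norm (inverse (qpoch q q n)) \<le> K2"
    by (rule qpoch_bounds[of q q]) (use assms in simp, use assms in simp, rule that)
  show ?thesis
  proof (rule summable_comparison_test)
    show "summable (\<lambda>j. (K1 * K2) * norm ((q ^ 2) ^ (j choose 2) * (A * norm x * norm t) ^ j))"
      using assms by (intro summable_mult summable_power_choose_2) (simp add: power_less_one_iff)
    have "norm (q_laguerre_coeff q \<alpha> x j * t ^ j)
        = norm (inverse (qpoch A q j)) * norm (inverse (qpoch q q j))
          * norm ((q ^ 2) ^ (j choose 2) * (A * norm x * norm t) ^ j)" for j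
      unfolding q_laguerre_coeff_def powr_square_add[OF assms(1)] A_def[symmetric]
      by (simp add: norm_mult norm_power power_mult_distrib divide_inverse abs_mult norm_inverse power_abs mult_ac)
    also have "\<dots> j \<le> K1 * K2 * norm ((q ^ 2) ^ (j choose 2) * (A * norm x * norm t) ^ j)" for j
      using order_trans[OF norm_ge_zero K1[of 0]]
      by (intro mult_right_mono mult_mono K1 K2) auto
    finally show "\<exists>N. \<forall>j\<ge>N. norm (norm (q_laguerre_coeff q \<alpha> x j * t ^ j))
        \<le> (K1 * K2) * norm ((q ^ 2) ^ (j choose 2) * (A * norm x * norm t) ^ j)"
      by simp
  qed
qed

lemma double_choose_2: "2 * (n choose 2) = n * (n - 1)"
  by (induction n) (auto simp: Suc_choose_2 algebra_simps split: nat_diff_split)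

lemma suminf_q_laguerre_coeff:
  fixes t x :: complex
  assumes "0 < q"
  shows "(\<Sum>j. q_laguerre_coeff q \<alpha> x j * t ^ j)
    = phi01 (of_real (q powr (\<alpha> + 1))) (of_real q) (- of_real (q powr (\<alpha> + 1)) * x * t)"
  unfolding phi01_def q_laguerre_coeff_def powr_square_add[OF assms] double_choose_2[symmetric]
  by (intro suminf_cong) (simp add: of_real_qpoch power_mult power_mult_distrib power_minus[of "_ * _"] power_minus[of x] mult_ac)

text \<open>The convolution form turns this into a Cauchy product of an entire series in
  \<open>t\<close> and Euler's series at \<open>y * t\<close>.\<close>

lemma q_laguerre_generating_function:
  fixes t x y :: complex
  assumes q: "0 < q" "q < 1" and alpha: "\<alpha> > -1" and yt: "norm (y * t) < 1"
  shows "(\<lambda>n. q_laguerre q \<alpha> n x y / of_real (qpoch q q n) * t ^ n) sums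
    (phi01 (of_real (q powr (\<alpha> + 1))) (of_real q) (- of_real (q powr (\<alpha> + 1)) * x * t)
       / qpoch_inf (y * t) (of_real q))"
proof -
  define Q where "Q = complex_of_real q"
  have Q: "norm Q < 1" using q by (simp add: Q_def)
  have "(\<lambda>n. \<Sum>j\<le>n. (q_laguerre_coeff q \<alpha> x j * t ^ j) * ((y * t) ^ (n - j) / qpoch Q Q (n - j))) sums
    ((\<Sum>j. q_laguerre_coeff q \<alpha> x j * t ^ j) * (\<Sum>n. (y * t) ^ n / qpoch Q Q n))"
    by (intro Cauchy_product_sums summable_q_laguerre_coeff summable_inverse_qpoch q alpha Q yt)
  also have "(\<lambda>n. \<Sum>j\<le>n. (q_laguerre_coeff q \<alpha> x j * t ^ j) * ((y * t) ^ (n - j) / qpoch Q Q (n - j)))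
    = (\<lambda>n. q_laguerre q \<alpha> n x y / of_real (qpoch q q n) * t ^ n)"
  proof
    fix n
    show "(\<Sum>j\<le>n. (q_laguerre_coeff q \<alpha> x j * t ^ j) * ((y * t) ^ (n - j) / qpoch Q Q (n - j)))
      = q_laguerre q \<alpha> n x y / of_real (qpoch q q n) * t ^ n"
      unfolding q_laguerre_div_qpoch[OF q] sum_distrib_right Q_def[symmetric]
    proof (intro sum.cong refl)
      fix j assume "j \<in> {..n}"
      then have "t ^ n = t ^ j * t ^ (n - j)"
        by (metis atMost_iff le_add_diff_inverse power_add)
      then show "(q_laguerre_coeff q \<alpha> x j * t ^ j) * ((y * t) ^ (n - j) / qpoch Q Q (n - j))
        = q_laguerre_coeff q \<alpha> x j * y ^ (n - j) / qpoch Q Q (n - j) * t ^ n"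
        by (simp add: power_mult_distrib)
    qed
  qed
  finally show ?thesis
    unfolding suminf_q_laguerre_coeff[OF q(1)] qpoch_inf_inverse_series[OF Q yt]
    by (simp add: Q_def divide_inverse)
qed

text \<open>The convolution bound with w = y t; the weight 4^j is supplied by summability of the
  coefficient series at 4t.\<close>

lemma q_laguerre_geometric_bound:
  fixes t x y :: complex
  assumes q: "0 < q" "q < 1" and alpha: "\<alpha> > -1"
    and lim: "(\<lambda>n. q_laguerre q \<alpha> n x y / of_real (qpoch q q n) * t ^ n) \<longlonglongrightarrow> 0"
  obtains C \<rho> where "0 < \<rho>" "\<rho> < 1"
    "\<And>n. norm (q_laguerre q \<alpha> n x y / of_real (qpoch q q n) * t ^ n) \<le> C * \<rho> ^ n"
proof -
  define Q where "Q = complex_of_real q"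
  have Q: "norm Q < 1" using q by (simp add: Q_def)
  have eq: "q_laguerre q \<alpha> n x y / of_real (qpoch q q n) * t ^ n
    = (\<Sum>j\<le>n. q_laguerre_coeff q \<alpha> x j * t ^ j * (y * t) ^ (n - j) / qpoch Q Q (n - j))" for n
    unfolding q_laguerre_div_qpoch[OF q] sum_distrib_right Q_def[symmetric]
  proof (intro sum.cong refl)
    fix j assume "j \<in> {..n}"
    then have "t ^ n = t ^ j * t ^ (n - j)"
      by (metis atMost_iff le_add_diff_inverse power_add)
    then show "q_laguerre_coeff q \<alpha> x j * y ^ (n - j) / qpoch Q Q (n - j) * t ^ n
      = q_laguerre_coeff q \<alpha> x j * t ^ j * (y * t) ^ (n - j) / qpoch Q Q (n - j)"
      by (simp add: power_mult_distrib)
  qed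
  have "summable (\<lambda>j. norm (q_laguerre_coeff q \<alpha> x j * t ^ j) * 4 ^ j)"
    using summable_q_laguerre_coeff[OF q alpha, of x "t * 4"]
    by (simp add: norm_mult norm_power power_mult_distrib mult_ac)
  from geometric_bound_convolution_qpoch[OF Q this lim[unfolded eq]]
  show ?thesis unfolding eq[symmetric] using that .
qed

text \<open>\<open>z_bound\<close> keeps the argument of the reciprocal product inside the unit disc
  for every real \<theta>, so the product never vanishes and Euler's expansion applies.
  \<open>series_converges\<close> asks only for pointwise convergence of the inner series;
  domination is derived from it.\<close>

theorem theorem5p2:
  fixes m k \<alpha> q :: real and x y z :: complex
  assumes alpha: "\<alpha> > -1"
    and q_def: "q = exp (- 2 * k ^ 2)" and q_pos: "0 < q" and q_less: "q < 1"
    and yzq: "norm (y * z * of_real q) < 1"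
    and z_bound: "norm (z * of_real (sqrt q)) < 1"
    and series_converges:
      "\<And>\<theta>::real. summable (\<lambda>n. q_laguerre q \<alpha> n x y
          * rogers_szego q n (- of_real q * exp (2 * of_real m * of_real k * \<i>))
                             (of_real (sqrt q) * exp (2 * of_real k * \<i> * of_real \<theta>))
          / of_real (qpoch q q n))"
  shows "has_bochner_integral lborel
     (\<lambda>\<theta>::real.
        of_real (exp (- (\<theta> ^ 2) + 2 * m * \<theta>))
        / qpoch_inf (z * of_real (sqrt q) * exp (- 2 * \<i> * of_real k * of_real \<theta>)) (of_real q)
        * (\<Sum>n. q_laguerre q \<alpha> n x y
            * rogers_szego q n (- of_real q * exp (2 * of_real m * of_real k * \<i>))
                               (of_real (sqrt q) * exp (2 * of_real k * \<i> * of_real \<theta>))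
            / of_real (qpoch q q n)))
     (of_real (sqrt pi * exp (m ^ 2))
        * (qpoch_inf (- z * of_real q * exp (- 2 * of_real m * of_real k * \<i>)) (of_real q)
           / qpoch_inf (y * z * of_real q) (of_real q))
        * phi01 (of_real (q powr (\<alpha> + 1))) (of_real q) (- of_real (q powr (\<alpha> + 2)) * x * z))"
proof -
  define Q S T :: complex where "Q = of_real q" and "S = of_real (sqrt q)"
    and "T = exp (2 * of_real m * of_real k * \<i>)"
  define c where "c n = q_laguerre q \<alpha> n x y / of_real (qpoch q q n)" for n
  define X :: "real \<Rightarrow> complex" where "X \<theta> = exp (2 * of_real k * \<i> * of_real \<theta>)" for \<theta>
  define R where "R n \<theta> = rogers_szego q n (- Q * T) (S * X \<theta>)" for n \<theta>
  define U where "U \<theta> = z * S * exp (- 2 * \<i> * of_real k * of_real \<theta>)" for \<theta>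
  define g where "g \<theta> = exp (- (\<theta> ^ 2) + 2 * m * \<theta>)" for \<theta>
  define c0 where "c0 = complex_of_real (sqrt pi * exp (m ^ 2))"
  define P where "P = qpoch_inf (- z * Q * exp (- 2 * of_real m * of_real k * \<i>)) Q"
  have Q1: "norm Q < 1" using q_pos q_less by (simp add: Q_def)
  have nX: "norm (X \<theta>) = 1" and nT: "norm T = 1" for \<theta> by (simp_all add: X_def T_def)
  have nS: "norm S = sqrt q" using q_pos by (simp add: S_def)
  have QSS: "Q = of_real (sqrt q) * S"
    using q_pos by (simp add: Q_def S_def flip: of_real_mult)
  have conv: "summable (\<lambda>n. c n * R n \<theta>)" for \<theta>
    using series_converges[of \<theta>] by (simp add: c_def R_def Q_def S_def T_def X_def)
  have k0: "k \<noteq> 0" using q_less by (auto simp: q_def)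

  text \<open>At this point both arguments of the Rogers-Szego polynomials have the same phase, so
    there is no cancellation and convergence of the series forces decay of its coefficients.\<close>
  define \<theta>0 where "\<theta>0 = m - pi / (2 * k)"
  have "X \<theta>0 = - T"
  proof -
    have "2 * of_real k * \<i> * of_real \<theta>0 = 2 * of_real m * of_real k * \<i> - \<i> * of_real pi"
      using k0 by (simp add: \<theta>0_def field_simps)
    then show ?thesis by (simp add: X_def T_def exp_diff)
  qed
  then have "- Q * T = of_real (sqrt q) * (S * X \<theta>0)" by (simp add: QSS)
  then have "norm (S * X \<theta>0) ^ n \<le> norm (R n \<theta>0)" for n
    unfolding R_def using norm_rogers_szego_ge[of q "sqrt q" "S * X \<theta>0" n] q_pos q_less by simp
  then have Rge: "norm S ^ n \<le> norm (R n \<theta>0)" for n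
    by (simp add: norm_mult nX)
  \<comment> \<open>At \<theta>0 the polynomial is at least |S|^n, so c_n S^n is dominated by the
    terms of a convergent series.\<close>
  have "(\<lambda>n. c n * S ^ n) \<longlonglongrightarrow> 0"
  proof (rule Lim_null_comparison)
    show "(\<lambda>n. norm (c n * R n \<theta>0)) \<longlonglongrightarrow> 0"
      by (intro tendsto_norm_zero summable_LIMSEQ_zero conv)
    show "\<forall>\<^sub>F n in sequentially. norm (c n * S ^ n) \<le> norm (c n * R n \<theta>0)"
      using Rge by (simp add: norm_mult norm_power mult_left_mono)
  qed
  then obtain C \<rho> where \<rho>: "0 < \<rho>" "\<rho> < 1" and C: "\<And>n. norm (c n * S ^ n) \<le> C * \<rho> ^ n"
    unfolding c_def by (rule q_laguerre_geometric_bound[OF q_pos q_less alpha]) (rule that[unfolded c_def])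

  obtain K where K: "K > 0"
    "\<And>n x y. norm x \<le> sqrt q * norm y \<Longrightarrow> norm (rogers_szego q n x y) \<le> K * norm y ^ n"
    by (rule norm_rogers_szego_le[of q "sqrt q"])
       (use q_pos q_less in simp, use q_pos in simp, use q_less in simp, rule that)
  have R: "norm (R n \<theta>) \<le> K * norm S ^ n" for n \<theta>
    using K(2)[of "- Q * T" "S * X \<theta>" n] q_pos
    by (simp add: R_def norm_mult nX nT nS QSS)
  define M where "M = (\<Sum>n. norm ((z * S) ^ n / qpoch Q Q n))"
  have M: "norm (inverse (qpoch_inf (U \<theta>) Q)) \<le> M" for \<theta>
  proof -
    have U: "norm (U \<theta>) = norm (z * S)" by (simp add: U_def norm_mult)
    then have "norm (inverse (qpoch_inf (U \<theta>) Q)) \<le> (\<Sum>n. norm (U \<theta> ^ n / qpoch Q Q n))"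
      using z_bound by (intro norm_inverse_qpoch_inf_le Q1) (simp add: S_def)
    then show ?thesis by (simp only: M_def norm_divide norm_power U)
  qed
  have M0: "0 \<le> M" using order_trans[OF norm_ge_zero M[of 0]] .

  define f where "f n \<theta> = of_real (g \<theta>) / qpoch_inf (U \<theta>) Q * R n \<theta> * c n" for n \<theta>
  define I where "I n = c0 * (z * Q) ^ n * P * c n" for n
  have fI: "has_bochner_integral lborel (f n) (I n)" for n
    unfolding f_def[abs_def] I_def g_def U_def R_def c0_def Q_def S_def T_def X_def P_def
    by (intro has_bochner_integral_mult_left has_bochner_integral_gaussian_rogers_szego q_def q_less z_bound)
  have g: "integrable lborel g"
  proof -
    have "integrable lborel (\<lambda>\<theta>. complex_of_real (g \<theta>))"
      using has_bochner_integral_gaussian_exp[of m 0] by (simp add: has_bochner_integral_iff g_def)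
    from integrable_norm[OF this] show ?thesis by (simp add: g_def[abs_def])
  qed
  \<comment> \<open>M bounds the reciprocal product, K |S|^n the polynomial, and C \<rho>^n the
    product |c_n| |S|^n; none of these depends on \<theta>.\<close>
  have B: "summable (\<lambda>n. (M * K * C) * \<rho> ^ n)"
    using \<rho> by (intro summable_mult summable_geometric) simp
  have bound: "norm (f n \<theta>) \<le> (M * K * C) * \<rho> ^ n * g \<theta>" for n \<theta>
  proof -
    have "norm (f n \<theta>) = g \<theta> * norm (inverse (qpoch_inf (U \<theta>) Q)) * (norm (R n \<theta>) * norm (c n))"
      by (simp add: f_def norm_mult norm_divide divide_inverse norm_inverse g_def)
    also have "\<dots> \<le> g \<theta> * M * ((K * norm S ^ n) * norm (c n))"
      using M0 by (intro mult_mono mult_left_mono mult_right_mono M R) (auto simp: g_def)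
    also have "\<dots> = g \<theta> * M * K * norm (c n * S ^ n)"
      by (simp add: norm_mult norm_power)
    also have "\<dots> \<le> g \<theta> * M * K * (C * \<rho> ^ n)"
      using M0 K(1) by (intro mult_left_mono C) (auto simp: g_def)
    finally show ?thesis by (simp only: mult_ac)
  qed
  have "has_bochner_integral lborel (\<lambda>\<theta>. \<Sum>n. f n \<theta>) (\<Sum>n. I n)"
    by (rule has_bochner_integral_suminf(1)[OF fI g B bound])
  also have "(\<lambda>\<theta>. \<Sum>n. f n \<theta>) = (\<lambda>\<theta>. of_real (g \<theta>) / qpoch_inf (U \<theta>) Q * (\<Sum>n. c n * R n \<theta>))"
  proof
    fix \<theta>
    have "(\<Sum>n. f n \<theta>) = (\<Sum>n. of_real (g \<theta>) / qpoch_inf (U \<theta>) Q * (c n * R n \<theta>))"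
      by (simp add: f_def mult_ac)
    then show "(\<Sum>n. f n \<theta>) = of_real (g \<theta>) / qpoch_inf (U \<theta>) Q * (\<Sum>n. c n * R n \<theta>)"
      by (simp only: suminf_mult[OF conv])
  qed
  also have "(\<Sum>n. I n) = c0 * P * (phi01 (of_real (q powr (\<alpha> + 1))) Q (- of_real (q powr (\<alpha> + 1)) * x * (z * Q))
       / qpoch_inf (y * (z * Q)) Q)"
  proof -
    have "(\<lambda>n. c n * (z * Q) ^ n) sums
      (phi01 (of_real (q powr (\<alpha> + 1))) Q (- of_real (q powr (\<alpha> + 1)) * x * (z * Q))
       / qpoch_inf (y * (z * Q)) Q)"
      unfolding c_def Q_def
      using yzq by (intro q_laguerre_generating_function q_pos q_less alpha) (simp add: mult.assoc)
    from sums_unique[OF sums_mult[OF this, of "c0 * P"]] show ?thesis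
      by (simp add: I_def mult_ac)
  qed
  \<comment> \<open>The generating function is taken at t = zq, and this extra q raises the exponent
    from \<alpha> + 1 to \<alpha> + 2.\<close>
  also have "- of_real (q powr (\<alpha> + 1)) * x * (z * Q) = - of_real (q powr (\<alpha> + 2)) * x * z"
  proof -
    have "q powr (\<alpha> + 2) = q powr (\<alpha> + 1) * q"
      using q_pos powr_add[of q "\<alpha> + 1" 1] by (simp add: algebra_simps)
    then show ?thesis by (simp add: Q_def)
  qed
  finally show ?thesis
    by (simp add: c_def R_def Q_def S_def T_def X_def U_def g_def c0_def P_def mult_ac)
qed

end
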